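(* Let $W=\{1=w_1<w_2<\cdots\}$ be an infinite set of integers with least element $1$, and let $$\overline{W}=\mathbb{Z}^+\setminus W=\{\overline{w_1}<\overline{w_2}<\cdots\}$$ be its complement in the set $\mathbb{Z}^+$ of positive integers, assumed infinite and listed in increasing order. If there exists a sequence of positive integers $i_1<i_2<\cdots$ such that $$\lim_{t\rightarrow+\infty}\left(\overline{w_{i_t+1}}-\overline{w_{i_t}}\right)=+\infty \quad\text{and}\quad \limsup_{t\rightarrow+\infty}\big|\overline{W}\cap(\overline{w_{i_{t}}},\overline{w_{i_{t+1}}})\big|<+\infty,$$ then there does not exist a minimal complement to $W$.
   Context: For $C,W\subseteq\mathbb{Z}$, $C+W=\{c+w: c\in C,\ w\in W\}$. The set $C$ is called an (additive) complement to $W$ if $C+W=\mathbb{Z}$. A complement $C$ to $W$ is called a minimal (additive) complement to $W$ if no proper subset of $C$ is a complement to $W$. In the hypotheses, $\overline{w_j}$ denotes the $j$-th smallest element of $\overline{W}$. Thus $\overline{w_{i_t+1}}$ is the element of $\overline{W}$ with index $i_t+1$ (the immediate successor of $\overline{w_{i_t}}$ in $\overline{W}$), while $\overline{w_{i_{t+1}}}$ is the element of $\overline{W}$ with index $i_{t+1}$. $(a,b)$ denotes the open interval. *)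

theory Defs
  imports Complex_Main "HOL-Library.Set_Algebras" "HOL-Library.Extended_Real"
begin

text \<open>The sum \<open>C + W\<close> is the elementwise sum of sets from \<^theory>\<open>HOL-Library.Set_Algebras\<close>.\<close>

definition additive_complement :: "int set \<Rightarrow> int set \<Rightarrow> bool" where
  "additive_complement C W \<longleftrightarrow> C + W = UNIV"

definition minimal_additive_complement :: "int set \<Rightarrow> int set \<Rightarrow> bool" where
  "minimal_additive_complement C W \<longleftrightarrow>
     additive_complement C W \<and> (\<forall>C'. C' \<subset> C \<longrightarrow> \<not> additive_complement C' W)"

text \<open>Listings are indexed from 1, so that \<open>a j\<close> is the \<open>j\<close>-th smallest element of \<open>A\<close>;
  the value \<open>a 0\<close> is irrelevant.\<close>

definition increasing_listing :: "(nat \<Rightarrow> int) \<Rightarrow> int set \<Rightarrow> bool" where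
  "increasing_listing a A \<longleftrightarrow> strict_mono_on {1..} a \<and> a ` {1..} = A"

end

(* Each element c of a minimal complement C has a witness n c that only c covers, so n c - c' lies in
   Wbar for every other c' < n c in C. Since W is bounded below, C is unbounded below. Fix finitely
   many witnesses and let c' tend to minus infinity: all the numbers n c - c' are elements of Wbar, far
   out, within a fixed distance of each other. The long gaps of Wbar force them into a single block
   between two consecutive gaps, but there may be more of them than a block has elements. *)
theory Submission
  imports Defs
begin

lemma additive_complement_below:
  assumes "additive_complement C W" and "\<forall>w\<in>W. 1 \<le> w"
  obtains c where "c \<in> C" and "c < b"
proof -
  have "b \<in> C + W"
    using assms(1) by (simp add: additive_complement_def)
  then obtain c w where "c \<in> C" "w \<in> W" "b = c + w"
    by (auto elim: set_plus_elim)
  with assms(2) show ?thesis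
    by (intro that[of c]) auto
qed

lemma infinite_additive_complement:
  assumes "additive_complement C W" and "\<forall>w\<in>W. 1 \<le> w"
  shows "infinite C"
proof
  assume fin: "finite C"
  obtain c where "c \<in> C" "c < Min C"
    using additive_complement_below[OF assms] .
  with fin show False
    by (simp add: Min_le leD)
qed

text \<open>Deleting \<open>c\<close> from \<open>C\<close> must uncover some integer
  \<open>n\<close>; since \<open>C\<close> itself covers \<open>n\<close>, only \<open>c\<close> can
  do it.\<close>

lemma minimal_additive_complement_witness:
  assumes "minimal_additive_complement C W" and "c \<in> C"
  shows "\<exists>n. n - c \<in> W \<and> (\<forall>c'\<in>C. c' \<noteq> c \<longrightarrow> n - c' \<notin> W)"
proof -
  have "C - {c} \<subset> C"
    using assms(2) by auto
  with assms(1) have "C + W = UNIV" "(C - {c}) + W \<noteq> UNIV"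
    by (auto simp: minimal_additive_complement_def additive_complement_def)
  then obtain n where n: "n \<notin> (C - {c}) + W" "n \<in> C + W"
    by auto
  have nW: "n - c' \<notin> W" if "c' \<in> C" "c' \<noteq> c" for c'
    using n(1) set_plus_intro[of c' "C - {c}" "n - c'" W] that by auto
  obtain c' w where c': "c' \<in> C" "w \<in> W" "n = c' + w"
    using n(2) by (auto elim: set_plus_elim)
  with nW[of c'] have "c' = c"
    by auto
  with c' nW show ?thesis
    by (intro exI[of _ n]) auto
qed

text \<open>Used to find the block that holds a given index \<open>k\<close>. The bound
  \<open>T \<le> t\<close> keeps that block in the range where the eventual estimates on gaps and
  blocks apply.\<close>

lemma strict_mono_bracket:
  fixes i :: "nat \<Rightarrow> nat"
  assumes "strict_mono i" and "i T < k"
  obtains t where "T \<le> t" and "i t < k" and "k \<le> i (Suc t)"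
proof -
  define s where "s = (LEAST s. k \<le> i s)"
  \<comment> \<open>The least \<open>s\<close> exists because \<open>k\<close> itself qualifies: a
    strictly increasing \<open>i\<close> on the naturals has \<open>k \<le> i k\<close>.\<close>
  have ks: "k \<le> i s"
    unfolding s_def by (rule LeastI[of _ k]) (rule strict_mono_imp_increasing[OF assms(1)])
  with assms have "T < s"
    using strict_mono_less[OF assms(1)] by (meson less_le_trans)
  then obtain t where t: "s = Suc t" "T \<le> t"
    by (cases s) auto
  have "i t < k"
    using not_less_Least[of t "\<lambda>s. k \<le> i s"] t(1) by (simp add: s_def)
  with t ks show ?thesis
    by (intro that[of t]) auto
qed

lemma increasing_listing_less_iff:
  assumes "increasing_listing a A" and "1 \<le> j" and "1 \<le> k"
  shows "a j < a k \<longleftrightarrow> j < k"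
  using assms strict_mono_on_less[of "{1..}" a j k] by (auto simp: increasing_listing_def)

text \<open>Turns a bound on the number of elements inside a block into a bound on the difference of
  its end indices. The \<open>Suc\<close> reflects that both endpoints are excluded.\<close>

lemma increasing_listing_card_between:
  assumes "increasing_listing a A" and "1 \<le> j"
  shows "k - Suc j \<le> card (A \<inter> {a j<..<a k})"
proof -
  have "inj_on a {j<..<k}"
    using assms strict_mono_on_imp_inj_on[of "{1..}" a]
    by (auto simp: increasing_listing_def intro: inj_on_subset)
  then have "card (a ` {j<..<k}) = k - Suc j"
    by (simp add: card_image)
  moreover have "a ` {j<..<k} \<subseteq> A \<inter> {a j<..<a k}"
    using assms(2) by (auto simp: increasing_listing_less_iff[OF assms(1)])
      (use assms in \<open>auto simp: increasing_listing_def\<close>)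
  ultimately show ?thesis
    using card_mono[of "A \<inter> {a j<..<a k}" "a ` {j<..<k}"] by simp
qed

lemma eventually_le_of_limsup_finite:
  fixes f :: "nat \<Rightarrow> nat"
  assumes "limsup (\<lambda>t. ereal (real (f t))) < \<infinity>"
  obtains K where "eventually (\<lambda>t. f t \<le> K) sequentially"
proof -
  obtain r where "limsup (\<lambda>t. ereal (real (f t))) < ereal r"
    using less_PInf_Ex_of_nat assms by auto
  then have "eventually (\<lambda>t. ereal (real (f t)) < ereal r) sequentially"
    by (rule Limsup_lessD)
  then have "eventually (\<lambda>t. f t \<le> nat \<lceil>r\<rceil>) sequentially"
    by (rule eventually_mono) (simp, linarith)
  then show ?thesis
    by (rule that)
qed

text \<open>The block containing the least element of \<open>X\<close> ends at
  \<open>a (i (Suc t))\<close>, and the gap after it is longer than the spread \<open>r\<close> of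
  \<open>X\<close>, so \<open>X\<close> cannot reach beyond. What remains is at most
  \<open>K\<close> interior elements and the right endpoint.\<close>

lemma card_le_block:
  fixes i :: "nat \<Rightarrow> nat"
  assumes a: "increasing_listing a A" and i: "strict_mono i" "\<forall>t. 1 \<le> i t"
    and gap: "\<And>t. T \<le> t \<Longrightarrow> r < a (i t + 1) - a (i t)"
    and block: "\<And>t. T \<le> t \<Longrightarrow> card (A \<inter> {a (i t)<..<a (i (t + 1))}) \<le> K"
    and X: "X \<subseteq> A" "finite X" "\<And>x. x \<in> X \<Longrightarrow> a (i T) < x"
    and close: "\<And>x y. x \<in> X \<Longrightarrow> y \<in> X \<Longrightarrow> y - x \<le> r"
  shows "card X \<le> Suc K"
proof (cases "X = {}")
  case False
  have index: "\<exists>k\<ge>1. x = a k" if "x \<in> X" for x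
    using a X(1) that by (auto simp: increasing_listing_def)
  define m where "m = Min X"
  have m: "m \<in> X" "\<And>x. x \<in> X \<Longrightarrow> m \<le> x"
    using X(2) False by (auto simp: m_def)
  obtain k where k: "1 \<le> k" "m = a k"
    using index[OF m(1)] by auto
  have "i T < k"
    using X(3)[OF m(1)] k i(2) by (simp add: increasing_listing_less_iff[OF a])
  then obtain t where t: "T \<le> t" "i t < k" "k \<le> i (Suc t)"
    using strict_mono_bracket[OF i(1)] by blast
  have "X \<subseteq> a ` {i t<..i (Suc t)}"
  proof
    fix x assume x: "x \<in> X"
    obtain l where l: "1 \<le> l" "x = a l"
      using index[OF x] by auto
    have "k \<le> l"
      using m(2)[OF x] k l increasing_listing_less_iff[OF a l(1) k(1)] by auto
    moreover have "l \<le> i (Suc t)"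
    proof (rule ccontr)
      \<comment> \<open>Otherwise the whole gap after \<open>a (i (Suc t))\<close> lies between
        \<open>m\<close> and \<open>x\<close>, which are at most \<open>r\<close> apart.\<close>
      assume "\<not> l \<le> i (Suc t)"
      then have "a (i (Suc t) + 1) \<le> a l"
        using increasing_listing_less_iff[OF a l(1), of "i (Suc t) + 1"] by (simp add: not_less[symmetric])
      moreover have "a k \<le> a (i (Suc t))"
        using t(3) k(1) i(2) increasing_listing_less_iff[OF a, of "i (Suc t)" k] by (simp add: not_less[symmetric])
      moreover have "r < a (i (Suc t) + 1) - a (i (Suc t))"
        using t(1) by (intro gap) simp
      ultimately show False
        using close[OF m(1) x] k l by linarith
    qed
    ultimately show "x \<in> a ` {i t<..i (Suc t)}"
      using l t(2) by auto
  qed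
  then have "card X \<le> card (a ` {i t<..i (Suc t)})"
    by (intro card_mono) auto
  also have "\<dots> \<le> i (Suc t) - i t"
    using card_image_le[of "{i t<..i (Suc t)}" a] by simp
  also have "\<dots> \<le> Suc K"
    using increasing_listing_card_between[OF a, of "i t" "i (Suc t)"] block[OF t(1)] i(2)
    by fastforce
  finally show ?thesis .
qed simp

theorem theorem1:
  fixes W Wbar :: "int set" and wbar :: "nat \<Rightarrow> int"
  assumes "infinite W"
    and "1 \<in> W" and "\<forall>w\<in>W. 1 \<le> w"
    and "Wbar = {0<..} - W"
    and "infinite Wbar"
    and "increasing_listing wbar Wbar"
    and "\<exists>i :: nat \<Rightarrow> nat. (\<forall>t. 1 \<le> i t) \<and> strict_mono i \<and>
           filterlim (\<lambda>t. wbar (i t + 1) - wbar (i t)) at_top sequentially \<and>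
           limsup (\<lambda>t. ereal (real (card (Wbar \<inter> {wbar (i t)<..<wbar (i (t + 1))})))) < \<infinity>"
  shows "\<not> (\<exists>C. minimal_additive_complement C W)"
proof
  assume "\<exists>C. minimal_additive_complement C W"
  then obtain C where C: "minimal_additive_complement C W" ..
  then have compl: "additive_complement C W"
    by (simp add: minimal_additive_complement_def)
  from assms(7) obtain i where i: "\<forall>t. 1 \<le> i t" "strict_mono i"
    and gap: "filterlim (\<lambda>t. wbar (i t + 1) - wbar (i t)) at_top sequentially"
    and lim: "limsup (\<lambda>t. ereal (real (card (Wbar \<inter> {wbar (i t)<..<wbar (i (t + 1))})))) < \<infinity>"
    by blast
  obtain K where K: "eventually (\<lambda>t. card (Wbar \<inter> {wbar (i t)<..<wbar (i (t + 1))}) \<le> K) sequentially"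
    using eventually_le_of_limsup_finite[OF lim] .
  obtain n where n: "\<And>c. c \<in> C \<Longrightarrow> n c - c \<in> W"
    "\<And>c c'. c \<in> C \<Longrightarrow> c' \<in> C \<Longrightarrow> c' \<noteq> c \<Longrightarrow> n c - c' \<notin> W"
    using minimal_additive_complement_witness[OF C] by metis
  \<comment> \<open>One more than the \<open>Suc K\<close> that \<open>card_le_block\<close>
    allows.\<close>
  obtain P where P: "P \<subseteq> C" "finite P" "card P = K + 2"
    using infinite_arbitrarily_large[OF infinite_additive_complement[OF compl assms(3)]] by metis
  \<comment> \<open>A witness shared by distinct \<open>c\<close> and \<open>c'\<close> would give
    \<open>n c - c'\<close> both inside and outside \<open>W\<close>.\<close>
  have inj: "inj_on n P"
    using n P(1) by (intro inj_onI) (metis subsetD)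
  define N where "N = n ` P"
  have N: "finite N" "card N = K + 2"
    using P inj by (auto simp: N_def card_image)
  \<comment> \<open>The spread of \<open>N\<close> does not change under translation, so
    \<open>T\<close> can be fixed before \<open>c\<close> is chosen.\<close>
  define r where "r = Max N - Min N"
  have "eventually (\<lambda>t. r < wbar (i t + 1) - wbar (i t)) sequentially"
    using gap[unfolded filterlim_at_top, rule_format, of "r + 1"]
    by (rule eventually_mono) linarith
  with K have "eventually (\<lambda>t. card (Wbar \<inter> {wbar (i t)<..<wbar (i (t + 1))}) \<le> K \<and>
    r < wbar (i t + 1) - wbar (i t)) sequentially"
    by (rule eventually_conj)
  then obtain T where T: "\<And>t. T \<le> t \<Longrightarrow> r < wbar (i t + 1) - wbar (i t)"
    "\<And>t. T \<le> t \<Longrightarrow> card (Wbar \<inter> {wbar (i t)<..<wbar (i (t + 1))}) \<le> K"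
    unfolding eventually_sequentially by blast
  have pos: "0 < wbar (i T)"
    using assms(4,6) i(1) by (auto simp: increasing_listing_def)
  \<comment> \<open>Being below \<open>Min P\<close> makes \<open>c\<close> differ from every
    \<open>p\<close> in \<open>P\<close>, so \<open>n p - c\<close> avoids \<open>W\<close>; the
    second bound pushes all these differences beyond \<open>wbar (i T)\<close>, hence also into the
    positive integers.\<close>
  obtain c where c: "c \<in> C" "c < min (Min P) (Min N - wbar (i T))"
    using additive_complement_below[OF compl assms(3)] .
  define X where "X = (\<lambda>x. x - c) ` N"
  have far: "wbar (i T) < x - c" if "x \<in> N" for x
    using c(2) Min_le[OF N(1) that] by simp
  have sub: "X \<subseteq> Wbar"
  proof
    fix x assume "x \<in> X"
    then obtain p where p: "p \<in> P" "x = n p - c"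
      by (auto simp: X_def N_def)
    have "c \<noteq> p"
      using c(2) Min_le[OF P(2) p(1)] by simp
    then have "x \<notin> W"
      using n(2) P(1) p c(1) by auto
    moreover have "0 < x"
      using far[of "n p"] pos p by (simp add: N_def)
    ultimately show "x \<in> Wbar"
      using assms(4) by simp
  qed
  have close: "y - x \<le> r" if xy: "x \<in> X" "y \<in> X" for x y
  proof -
    obtain x' y' where "x' \<in> N" "y' \<in> N" "x = x' - c" "y = y' - c"
      using xy by (auto simp: X_def)
    then show ?thesis
      using Min_le[OF N(1), of x'] Max_ge[OF N(1), of y'] by (simp add: r_def)
  qed
  have fin: "finite X" and large: "\<And>x. x \<in> X \<Longrightarrow> wbar (i T) < x"
    using N(1) far by (auto simp: X_def)
  have "card X \<le> Suc K"
    using card_le_block[OF assms(6) i(2,1) T sub fin large close] .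
  moreover have "card X = K + 2"
    using N by (simp add: X_def card_image inj_on_def)
  ultimately show False
    by simp
qed

end
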